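(* Let $(x_n)_{n\in\mathbb{Z}}$ be a sequence in a distance space $(X,d)$, and let $f:\mathbb{Z}\to\mathbb{Z}$ be a strictly monotone function such that $f(n)<f(n+1)$ for all $n\in\mathbb{Z}$. If $(x_n)_{n\in\mathbb{Z}}$ is Cauchy in $(X,d)$, then $(x_{f(n)})_{n\in\mathbb{Z}}$ is Cauchy in $(X,d)$.
   Context: A distance on a set $X$ is a function $d:X\times X\to\mathbb{R}$ such that for all $x,y\in X$: $d(x,y)\ge 0$; $d(x,y)=0\iff x=y$; $d(x,y)=d(y,x)$ (no triangle inequality is assumed). The pair $(X,d)$ is then a distance space. A sequence $(x_n)_{n\in\mathbb{Z}}$ in $X$ is Cauchy in $(X,d)$ if for every real $\varepsilon>0$ there exists $N\in\mathbb{Z}$ such that $d(x_n,x_m)<\varepsilon$ for all $n,m>N$. *)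

theory Defs
  imports Complex_Main
begin

locale distance_space =
  fixes X :: "'a set" and d :: "'a \<Rightarrow> 'a \<Rightarrow> real"
  assumes nonneg: "\<lbrakk>x \<in> X; y \<in> X\<rbrakk> \<Longrightarrow> 0 \<le> d x y"
    and zero_iff: "\<lbrakk>x \<in> X; y \<in> X\<rbrakk> \<Longrightarrow> d x y = 0 \<longleftrightarrow> x = y"
    and sym: "\<lbrakk>x \<in> X; y \<in> X\<rbrakk> \<Longrightarrow> d x y = d y x"

text \<open>Sequences are indexed by all integers, and the Cauchy condition concerns only the
  end at plus infinity. Being a sequence in \<open>X\<close> is part of the notion.\<close>

definition Cauchy_in :: "'a set \<Rightarrow> ('a \<Rightarrow> 'a \<Rightarrow> real) \<Rightarrow> (int \<Rightarrow> 'a) \<Rightarrow> bool" where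
  "Cauchy_in X d x \<longleftrightarrow> range x \<subseteq> X \<and>
    (\<forall>\<epsilon>>0. \<exists>N. \<forall>n m. n > N \<and> m > N \<longrightarrow> d (x n) (x m) < \<epsilon>)"

end

theory Submission
  imports Defs
begin

text \<open>A strictly increasing integer-valued map rises by at least 1 at each step, so it grows
  at least linearly (\<open>strict_mono_int_ge_add\<close>) and tends to plus infinity. Hence
  \<open>f n\<close> and \<open>f m\<close> eventually pass any Cauchy threshold \<open>N\<close> of
  \<open>x\<close>. On the integers \<open>f n \<ge> n\<close> can fail, as for a shift to the left,
  so the new threshold has to depend on a value of \<open>f\<close>.\<close>

lemma strict_mono_int_ge_add:
  fixes f :: "int \<Rightarrow> int"
  assumes "strict_mono f" and "k \<le> n"
  shows "f k + (n - k) \<le> f n"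
  using \<open>k \<le> n\<close>
proof (induction n rule: int_ge_induct)
  case base
  show ?case by simp
next
  case (step n)
  \<comment> \<open>By integrality this strict increase is at least 1, matching the growth of
    \<open>n - k\<close>.\<close>
  have "f n < f (n + 1)"
    by (rule strict_monoD[OF assms(1)]) simp
  with step.IH show ?case by simp
qed

theorem proposition3p15:
  fixes X :: "'a set" and d :: "'a \<Rightarrow> 'a \<Rightarrow> real"
    and x :: "int \<Rightarrow> 'a" and f :: "int \<Rightarrow> int"
  assumes "distance_space X d"
    and "range x \<subseteq> X"
    and "strict_mono f"
    and "\<And>n. f n < f (n + 1)"
    and "Cauchy_in X d x"
  shows "Cauchy_in X d (\<lambda>n. x (f n))"
  unfolding Cauchy_in_def
proof (intro conjI allI impI)
  show "range (\<lambda>n. x (f n)) \<subseteq> X"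
    using assms(2) by auto
next
  fix \<epsilon> :: real
  assume "\<epsilon> > 0"
  with assms(5) obtain N where N: "\<forall>n m. n > N \<and> m > N \<longrightarrow> d (x n) (x m) < \<epsilon>"
    unfolding Cauchy_in_def by meson
  \<comment> \<open>Growth is measured from the base point 0: the bound 0 gives
    \<open>0 \<le> n\<close>, so that \<open>f 0 + n \<le> f n\<close>, and the bound
    \<open>N - f 0\<close> makes \<open>f 0 + n\<close> exceed \<open>N\<close>.\<close>
  have f_gt: "f n > N" if "n > max 0 (N - f 0)" for n
  proof -
    have "f 0 + (n - 0) \<le> f n"
      by (rule strict_mono_int_ge_add[OF assms(3)]) (use that in linarith)
    with that show ?thesis by linarith
  qed
  show "\<exists>M. \<forall>n m. n > M \<and> m > M \<longrightarrow> d (x (f n)) (x (f m)) < \<epsilon>"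
  proof (intro exI allI impI)
    fix n m
    assume "n > max 0 (N - f 0) \<and> m > max 0 (N - f 0)"
    with f_gt N show "d (x (f n)) (x (f m)) < \<epsilon>" by simp
  qed
qed

end
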